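(* Fix $\theta_0\in(0,1)$ and $w_0>0$. For any interval $[a,b]\subset(-\sqrt2+1,\sqrt2-1)$ there exists a constant $C=C(w_0;a,b)>0$, independent of $\theta\in(0,\theta_0]$, such that for every $\theta\in(0,\theta_0]$ and every function $(\rho^{(\theta)},m^{(\theta)})(t,x)$ satisfying, for a.e. $(t,x)\in\mathbb{R}^2_+$, $$0\le\rho^{(\theta)}(t,x)\le e^{w_0},\qquad |m^{(\theta)}(t,x)|\le\rho^{(\theta)}(t,x)\big(|\ln\rho^{(\theta)}(t,x)|+w_0\big),$$ one has, a.e. in $\mathbb{R}^2_+$, $$\big|\eta_\xi^{(\theta)}(\rho^{(\theta)},m^{(\theta)})-\eta_\xi(\rho^{(\theta)},m^{(\theta)})\big|+\big|q_\xi^{(\theta)}(\rho^{(\theta)},m^{(\theta)})-q_\xi(\rho^{(\theta)},m^{(\theta)})\big|\le C\sqrt\theta\qquad\text{for any }\xi\in[a,b].$$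
   Context: $\mathbb{R}^2_+=(0,\infty)\times\mathbb{R}$; $[y]_+=\max(0,y)$. For $\theta\in(0,1)$ and $\xi\in(-1,1)$ define, for $\rho>0$, $m\in\mathbb{R}$, $$\eta_\xi^{(\theta)}(\rho,m)=\frac{\rho\int_{\mathbb{R}}e^{\frac{\xi}{1-\xi^2}\left(\frac m\rho+\frac{\rho^\theta}{\theta}\tau\right)}[1-\tau^2]_+^{\frac{1-\theta}{2\theta}}d\tau}{\int_{\mathbb{R}}e^{\frac{\xi\tau}{\theta(1-\xi^2)}}[1-\tau^2]_+^{\frac{1-\theta}{2\theta}}d\tau},\qquad q_\xi^{(\theta)}(\rho,m)=\frac{\rho\int_{\mathbb{R}}\left(\frac m\rho+\rho^\theta\tau\right)e^{\frac{\xi}{1-\xi^2}\left(\frac m\rho+\frac{\rho^\theta}{\theta}\tau\right)}[1-\tau^2]_+^{\frac{1-\theta}{2\theta}}d\tau}{\int_{\mathbb{R}}e^{\frac{\xi\tau}{\theta(1-\xi^2)}}[1-\tau^2]_+^{\frac{1-\theta}{2\theta}}d\tau}$$ (weak entropy pairs of the isentropic Euler equations with pressure $\rho^{2\theta+1}/(2\theta+1)$), and $$\eta_\xi(\rho,m)=\rho^{\frac{1}{1-\xi^2}}e^{\frac{\xi}{1-\xi^2}\frac m\rho},\qquad q_\xi(\rho,m)=\Big(\frac m\rho+\xi\Big)\eta_\xi(\rho,m)$$ (weak entropy pairs of the isothermal Euler equations with pressure $\rho$). All four functions are set equal to $0$ where $\rho=0$ (vacuum), and $\rho|\ln\rho|:=0$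 at $\rho=0$. *)

theory Defs
  imports "HOL-Analysis.Analysis"
begin

definition half_plane :: "(real \<times> real) set" where
  "half_plane = {0<..} \<times> UNIV"

(* The factor [1 - tau^2]_+ ^ ((1 - theta) / (2 theta)). The exponent is positive for
   0 < theta < 1, and 0 powr a = 0, so the kernel vanishes for |tau| >= 1. *)
definition chi :: "real \<Rightarrow> real \<Rightarrow> real" where
  "chi \<theta> \<tau> = max 0 (1 - \<tau>\<^sup>2) powr ((1 - \<theta>) / (2 * \<theta>))"

definition normalization_const :: "real \<Rightarrow> real \<Rightarrow> real" where
  "normalization_const \<theta> \<xi> =
    (\<integral>\<tau>. exp (\<xi> * \<tau> / (\<theta> * (1 - \<xi>\<^sup>2))) * chi \<theta> \<tau> \<partial>lborel)"

(* The entropy pairs of the isentropic system (pressure rho^(2 theta + 1) / (2 theta + 1)) and of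
   the isothermal system (pressure rho). All four functions are 0 at vacuum rho = 0; the value 0
   for rho < 0 is only a totalization. *)

definition eta_isentropic :: "real \<Rightarrow> real \<Rightarrow> real \<Rightarrow> real \<Rightarrow> real" where
  "eta_isentropic \<theta> \<xi> \<rho> m =
    (if \<rho> > 0 then
       \<rho> * (\<integral>\<tau>. exp (\<xi> / (1 - \<xi>\<^sup>2) * (m / \<rho> + \<rho> powr \<theta> / \<theta> * \<tau>)) * chi \<theta> \<tau> \<partial>lborel)
         / normalization_const \<theta> \<xi>
     else 0)"

definition q_isentropic :: "real \<Rightarrow> real \<Rightarrow> real \<Rightarrow> real \<Rightarrow> real" where
  "q_isentropic \<theta> \<xi> \<rho> m =
    (if \<rho> > 0 then
       \<rho> * (\<integral>\<tau>. (m / \<rho> + \<rho> powr \<theta> * \<tau>)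
              * exp (\<xi> / (1 - \<xi>\<^sup>2) * (m / \<rho> + \<rho> powr \<theta> / \<theta> * \<tau>)) * chi \<theta> \<tau> \<partial>lborel)
         / normalization_const \<theta> \<xi>
     else 0)"

definition eta_isothermal :: "real \<Rightarrow> real \<Rightarrow> real \<Rightarrow> real" where
  "eta_isothermal \<xi> \<rho> m =
    (if \<rho> > 0 then \<rho> powr (1 / (1 - \<xi>\<^sup>2)) * exp (\<xi> / (1 - \<xi>\<^sup>2) * (m / \<rho>)) else 0)"

definition q_isothermal :: "real \<Rightarrow> real \<Rightarrow> real \<Rightarrow> real" where
  "q_isothermal \<xi> \<rho> m = (if \<rho> > 0 then (m / \<rho> + \<xi>) * eta_isothermal \<xi> \<rho> m else 0)"

(* The pointwise bounds on (rho, m). At rho = 0 the right-hand side of the last bound is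
   0 * (|ln 0| + w0) = 0, in line with the convention rho |ln rho| = 0 there. *)
definition admissible_state :: "real \<Rightarrow> real \<Rightarrow> real \<Rightarrow> bool" where
  "admissible_state w\<^sub>0 \<rho> m \<longleftrightarrow>
    0 \<le> \<rho> \<and> \<rho> \<le> exp w\<^sub>0 \<and> \<bar>m\<bar> \<le> \<rho> * (\<bar>ln \<rho>\<bar> + w\<^sub>0)"

end

theory Submission
  imports Defs
begin

text \<open>
  Put \<open>k = \<xi> / (1 - \<xi>\<^sup>2)\<close>, \<open>L = ln \<rho>\<close>, \<open>u = m / \<rho>\<close>, and let \<open>N s\<close> be the integral of \<open>exp (s \<tau>) chi \<theta> \<tau>\<close>.
  The two densities are \<open>\<rho> e\<^bsup>k u\<^esup>\<close> times \<open>N (k \<rho>\<^bsup>\<theta>\<^esup> / \<theta>) / N (k / \<theta>)\<close> and \<open>e\<^bsup>k \<xi> L\<^esup>\<close> respectively.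
  Integration by parts against \<open>\<tau> - \<xi>\<close>, together with \<open>k (1 - \<xi>\<^sup>2) = \<xi>\<close> and \<open>\<bar>k\<bar> \<le> 1/2\<close>, shows that the
  probability density \<open>exp (s \<tau>) chi \<theta> \<tau> / N s\<close> with \<open>s = k \<rho>\<^bsup>\<theta>\<^esup> / \<theta>\<close> has mean \<open>\<xi> + O(\<surd>\<theta> (1 + \<bar>L\<bar>))\<close>.
  Since \<open>ln N\<close> is convex with this mean as its slope, the logarithms of the two factors differ by
  \<open>O(\<surd>\<theta> (1 + \<bar>L\<bar>)\<^sup>2)\<close>. Near vacuum both densities are \<open>O(\<rho>\<^bsup>1 - 2 \<bar>k\<bar>\<^esup>)\<close>, which absorbs the powers
  of \<open>L\<close> because \<open>\<bar>\<xi>\<bar> < \<surd>2 - 1\<close> means exactly \<open>\<bar>k\<bar> < 1/2\<close>.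
\<close>

section \<open>Moments of the kernel under exponential tilting\<close>

text \<open>Unnormalized expectation of \<open>f\<close> under the tilt by \<open>s\<close>. With
  \<open>f = 1\<close> it is \<open>N s\<close>, so the normalization and both isentropic numerators
  are expressible through it.\<close>

definition moment :: "real \<Rightarrow> real \<Rightarrow> (real \<Rightarrow> real) \<Rightarrow> real" where
  "moment \<theta> s f = (\<integral>\<tau>. f \<tau> * (exp (s * \<tau>) * chi \<theta> \<tau>) \<partial>lborel)"

lemma chi_nonneg: "0 \<le> chi \<theta> \<tau>"
  by (simp add: chi_def)

lemma chi_eq_0: "\<tau> \<notin> {-1..1} \<Longrightarrow> chi \<theta> \<tau> = 0"
proof -
  assume "\<tau> \<notin> {-1..1}"
  hence "1 < \<bar>\<tau>\<bar>" by auto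
  hence "1 < \<tau>\<^sup>2" by (metis abs_1 abs_square_le_1 linorder_not_le)
  thus ?thesis by (simp add: chi_def)
qed

text \<open>The exponent \<open>(1 - \<theta>) / (2 * \<theta>)\<close> is positive, which makes
  \<open>powr\<close> continuous at base 0, that is at \<tau> = 1 and \<tau> = -1.\<close>

lemma continuous_on_chi:
  assumes "0 < \<theta>" "\<theta> < 1"
  shows "continuous_on A (chi \<theta>)"
  unfolding chi_def using assms
  by (intro continuous_on_powr' continuous_intros) (auto intro!: divide_pos_pos)

text \<open>The integrand is continuous and vanishes off [-1,1]. The second form is a gauge integral
  on [-1,1], to which the fundamental theorem of calculus applies.\<close>

lemma
  assumes "0 < \<theta>" "\<theta> < 1" "continuous_on UNIV f"
  shows integrable_moment: "integrable lborel (\<lambda>\<tau>. f \<tau> * (exp (s * \<tau>) * chi \<theta> \<tau>))"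
    and has_integral_moment:
      "((\<lambda>\<tau>. f \<tau> * (exp (s * \<tau>) * chi \<theta> \<tau>)) has_integral moment \<theta> s f) {-1..1}"
proof -
  let ?g = "\<lambda>\<tau>. f \<tau> * (exp (s * \<tau>) * chi \<theta> \<tau>)"
  have eq: "(\<lambda>\<tau>. indicator {-1..1} \<tau> *\<^sub>R ?g \<tau>) = ?g"
    using chi_eq_0 by (fastforce simp: indicator_def)
  have c: "continuous_on {-1..1} ?g"
    using assms by (intro continuous_intros continuous_on_chi) (auto intro: continuous_on_subset)
  have i: "set_integrable lborel {-1..1} ?g"
    unfolding set_integrable_def by (intro borel_integrable_compact c) auto
  show "integrable lborel ?g"
    using i unfolding set_integrable_def eq .
  have "moment \<theta> s f = (LINT \<tau>:{-1..1}|lborel. ?g \<tau>)"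
    unfolding moment_def set_lebesgue_integral_def eq ..
  also have "(?g has_integral \<dots>) {-1..1}"
    using has_integral_set_lebesgue[of "{-1..1}" ?g] i
    by (metis set_borel_integral_eq_integral(1,2) integrable_integral)
  finally show "(?g has_integral moment \<theta> s f) {-1..1}" .
qed

lemma moment_add:
  assumes "0 < \<theta>" "\<theta> < 1" "continuous_on UNIV f" "continuous_on UNIV g"
  shows "moment \<theta> s (\<lambda>\<tau>. f \<tau> + g \<tau>) = moment \<theta> s f + moment \<theta> s g"
  using integrable_moment[OF assms(1-3)] integrable_moment[OF assms(1,2,4)]
  by (simp add: moment_def distrib_right)

lemma moment_cmult: "moment \<theta> s (\<lambda>\<tau>. c * f \<tau>) = c * moment \<theta> s f"
  by (simp add: moment_def mult.assoc)

lemma moment_const: "moment \<theta> s (\<lambda>\<tau>. c) = c * moment \<theta> s (\<lambda>\<tau>. 1)"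
  using moment_cmult[of \<theta> s c "\<lambda>_. 1"] by simp

lemma moment_mono:
  assumes "0 < \<theta>" "\<theta> < 1" "continuous_on UNIV f" "continuous_on UNIV g"
    and "\<And>\<tau>. \<tau> \<in> {-1..1} \<Longrightarrow> f \<tau> \<le> g \<tau>"
  shows "moment \<theta> s f \<le> moment \<theta> s g"
  unfolding moment_def
proof (rule integral_mono[OF integrable_moment integrable_moment])
  fix \<tau> :: real
  show "f \<tau> * (exp (s * \<tau>) * chi \<theta> \<tau>) \<le> g \<tau> * (exp (s * \<tau>) * chi \<theta> \<tau>)"
  proof (cases "\<tau> \<in> {-1..1}")
    case True
    thus ?thesis by (intro mult_right_mono assms mult_nonneg_nonneg chi_nonneg) auto
  qed (simp add: chi_eq_0)
qed (use assms in auto)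

lemma moment_1_pos:
  assumes "0 < \<theta>" "\<theta> < 1"
  shows "0 < moment \<theta> s (\<lambda>\<tau>. 1)"
proof -
  let ?\<alpha> = "(1 - \<theta>) / (2 * \<theta>)"
  \<comment> \<open>Lower bound for the density on [-1/2,1/2], where 1 - \<tau>^2 is at least
    3/4.\<close>
  let ?c = "exp (- \<bar>s\<bar>) * (3/4) powr ?\<alpha>"
  have "0 < (\<integral>\<tau>. ?c * indicator {-1/2..1/2::real} \<tau> \<partial>lborel)"
    by simp
  also have "\<dots> \<le> moment \<theta> s (\<lambda>\<tau>. 1)"
    unfolding moment_def
  proof (rule integral_mono[OF _ integrable_moment])
    fix \<tau> :: real
    show "?c * indicator {-1/2..1/2} \<tau> \<le> 1 * (exp (s * \<tau>) * chi \<theta> \<tau>)"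
    proof (cases "\<tau> \<in> {-1/2..1/2}")
      case True
      hence \<tau>: "\<bar>\<tau>\<bar> \<le> 1/2" by auto
      have "\<tau>\<^sup>2 \<le> (1/2)\<^sup>2" using \<tau> by (metis abs_le_square_iff abs_of_pos half_gt_zero zero_less_one)
      hence "3/4 \<le> max 0 (1 - \<tau>\<^sup>2)" by (simp add: power2_eq_square)
      hence "(3/4) powr ?\<alpha> \<le> chi \<theta> \<tau>"
        unfolding chi_def by (rule powr_mono2[rotated 2]) (use assms in auto)
      moreover have "\<bar>s * \<tau>\<bar> \<le> \<bar>s\<bar> * 1"
        unfolding abs_mult using \<tau> by (intro mult_left_mono) auto
      hence "exp (- \<bar>s\<bar>) \<le> exp (s * \<tau>)" by auto
      ultimately show ?thesis using True by (simp add: mult_mono)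
    qed (simp add: chi_nonneg)
  qed (use assms in auto)
  finally show ?thesis .
qed

section \<open>The mean of the tilted density\<close>

text \<open>The weighted integrand is the derivative of \<open>F\<close>, and \<open>F\<close>
  vanishes at both endpoints. Here \<open>k\<close> and \<open>\<xi>\<close> are unrelated, so
  \<open>k * r\<close> can later replace \<open>k\<close>.\<close>

lemma moment_integration_by_parts:
  assumes "0 < \<theta>" "\<theta> < 1"
  shows "moment \<theta> (k / \<theta>) (\<lambda>\<tau>. \<theta> * (1 - \<tau>\<^sup>2) + (\<tau> - \<xi>) * (k * (1 - \<tau>\<^sup>2) - (1 + \<theta>) * \<tau>)) = 0"
    (is "moment _ _ ?f = 0")
proof -
  define \<alpha> where "\<alpha> = (1 - \<theta>) / (2 * \<theta>)"
  have \<alpha>: "0 < \<alpha>" "\<theta> * (2 * (\<alpha> + 1)) = 1 + \<theta>"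
    using assms by (auto simp: \<alpha>_def field_simps)
  \<comment> \<open>The additional power of 1 - \<tau>^2 lets \<open>chi\<close> factor out of the
    derivative; the factor \<open>\<theta>\<close> cancels the 1/\<theta> in
    \<open>k / \<theta>\<close> and in \<open>\<alpha>\<close>.\<close>
  define F where "F = (\<lambda>\<tau>. \<theta> * (\<tau> - \<xi>) * exp (k / \<theta> * \<tau>) * (1 - \<tau>\<^sup>2) powr (\<alpha> + 1))"
  have "((\<lambda>\<tau>. ?f \<tau> * (exp (k / \<theta> * \<tau>) * chi \<theta> \<tau>)) has_integral F 1 - F (-1)) {-1..1}"
  \<comment> \<open>The power is differentiated only where its base is positive; at the endpoints
    continuity suffices.\<close>
  proof (rule fundamental_theorem_of_calculus_interior)
    show "continuous_on {-1..1} F"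
      unfolding F_def using \<alpha>(1)
      by (intro continuous_intros continuous_on_powr') (auto simp: abs_square_le_1 abs_le_iff)
    fix \<tau> :: real assume "\<tau> \<in> {-1<..<1}"
    hence pos: "0 < 1 - \<tau>\<^sup>2" using abs_square_less_1[of \<tau>] by auto
    have chi: "chi \<theta> \<tau> = (1 - \<tau>\<^sup>2) powr \<alpha>"
      using pos by (simp add: chi_def \<alpha>_def max_def)
    have p: "(1 - \<tau>\<^sup>2) powr (\<alpha> + 1) = (1 - \<tau>\<^sup>2) * (1 - \<tau>\<^sup>2) powr \<alpha>"
      using pos by (simp add: powr_add)
    have 1: "((\<lambda>\<tau>. (1 - \<tau>\<^sup>2) powr (\<alpha> + 1)) has_real_derivative
        (\<alpha> + 1) * (1 - \<tau>\<^sup>2) powr \<alpha> * (- 2 * \<tau>)) (at \<tau>)"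
      using pos by (auto intro!: derivative_eq_intros)
    have "(F has_real_derivative \<theta> * exp (k / \<theta> * \<tau>) * (1 - \<tau>\<^sup>2) powr (\<alpha> + 1)
        + \<theta> * (\<tau> - \<xi>) * (k / \<theta> * exp (k / \<theta> * \<tau>)) * (1 - \<tau>\<^sup>2) powr (\<alpha> + 1)
        + \<theta> * (\<tau> - \<xi>) * exp (k / \<theta> * \<tau>) * ((\<alpha> + 1) * (1 - \<tau>\<^sup>2) powr \<alpha> * (- 2 * \<tau>))) (at \<tau>)"
      unfolding F_def by (rule derivative_eq_intros 1 refl)+ (simp add: algebra_simps)
    \<comment> \<open>The grouping exposes \<open>\<theta> * (k / \<theta>)\<close> and
      \<open>\<theta> * (2 * (\<alpha> + 1))\<close>, which equal \<open>k\<close> and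
      \<open>1 + \<theta>\<close>.\<close>
    also have "\<theta> * exp (k / \<theta> * \<tau>) * (1 - \<tau>\<^sup>2) powr (\<alpha> + 1)
        + \<theta> * (\<tau> - \<xi>) * (k / \<theta> * exp (k / \<theta> * \<tau>)) * (1 - \<tau>\<^sup>2) powr (\<alpha> + 1)
        + \<theta> * (\<tau> - \<xi>) * exp (k / \<theta> * \<tau>) * ((\<alpha> + 1) * (1 - \<tau>\<^sup>2) powr \<alpha> * (- 2 * \<tau>))
      = (\<theta> * (1 - \<tau>\<^sup>2) + (\<tau> - \<xi>) * ((\<theta> * (k / \<theta>)) * (1 - \<tau>\<^sup>2) - (\<theta> * (2 * (\<alpha> + 1))) * \<tau>))
        * (exp (k / \<theta> * \<tau>) * chi \<theta> \<tau>)"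
      unfolding p chi by (simp only: algebra_simps)
    also have "\<theta> * (k / \<theta>) = k" using assms by simp
    finally have "(F has_real_derivative ?f \<tau> * (exp (k / \<theta> * \<tau>) * chi \<theta> \<tau>)) (at \<tau>)"
      unfolding \<alpha>(2) .
    thus "(F has_vector_derivative ?f \<tau> * (exp (k / \<theta> * \<tau>) * chi \<theta> \<tau>)) (at \<tau>)"
      by (simp add: has_real_derivative_iff_has_vector_derivative)
  qed simp
  moreover have "F 1 - F (-1) = 0" by (simp add: F_def)
  ultimately have 1: "((\<lambda>\<tau>. ?f \<tau> * (exp (k / \<theta> * \<tau>) * chi \<theta> \<tau>)) has_integral 0) {-1..1}"
    by (simp only:)
  have 2: "((\<lambda>\<tau>. ?f \<tau> * (exp (k / \<theta> * \<tau>) * chi \<theta> \<tau>)) has_integral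
      moment \<theta> (k / \<theta>) ?f) {-1..1}"
    by (rule has_integral_moment) (use assms in \<open>auto intro!: continuous_intros\<close>)
  show ?thesis by (rule has_integral_unique[OF 2 1])
qed

definition mean :: "real \<Rightarrow> real \<Rightarrow> real" where
  "mean \<theta> s = moment \<theta> s (\<lambda>\<tau>. \<tau>) / moment \<theta> s (\<lambda>\<tau>. 1)"

lemma moment_id:
  assumes "0 < \<theta>" "\<theta> < 1"
  shows "moment \<theta> s (\<lambda>\<tau>. \<tau>) = mean \<theta> s * moment \<theta> s (\<lambda>\<tau>. 1)"
  using moment_1_pos[OF assms, of s] by (simp add: mean_def)

lemma moment_affine:
  assumes "0 < \<theta>" "\<theta> < 1"
  shows "moment \<theta> s (\<lambda>\<tau>. c + d * \<tau>) = (c + d * mean \<theta> s) * moment \<theta> s (\<lambda>\<tau>. 1)"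
  using assms
  by (simp add: moment_add moment_cmult moment_const[of _ _ c] moment_id continuous_intros distrib_right)

lemma abs_mean_le_1:
  assumes "0 < \<theta>" "\<theta> < 1"
  shows "\<bar>mean \<theta> s\<bar> \<le> 1"
proof -
  have "moment \<theta> s (\<lambda>\<tau>. \<tau>) \<le> moment \<theta> s (\<lambda>\<tau>. 1)"
    by (rule moment_mono) (use assms in \<open>auto intro!: continuous_intros\<close>)
  moreover have "moment \<theta> s (\<lambda>\<tau>. -1) \<le> moment \<theta> s (\<lambda>\<tau>. \<tau>)"
    by (rule moment_mono) (use assms in \<open>auto intro!: continuous_intros\<close>)
  ultimately show ?thesis
    using moment_1_pos[OF assms, of s] moment_const[of \<theta> s "-1"]
    by (simp add: mean_def field_simps abs_le_iff)
qed

text \<open>From \<open>k * (1 - \<xi>\<^sup>2) = \<xi>\<close> follows k (1 - \<tau>^2) - \<tau> =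
  -(\<tau> - \<xi>) (1 + k (\<xi> + \<tau>)). Integration by parts thus controls the second moment
  of \<tau> - \<xi>, up to errors from \<theta> and r - 1, and Jensen's inequality passes to the
  mean.\<close>

lemma mean_sub_sq_le:
  fixes \<theta> k \<xi> r :: real
  assumes "0 < \<theta>" "\<theta> < 1"
    and k: "\<bar>k\<bar> \<le> 1/2" "k * (1 - \<xi>\<^sup>2) = \<xi>" "0 \<le> k * \<xi>"
  defines "\<delta> \<equiv> \<bar>k\<bar> * \<bar>r - 1\<bar> + \<theta>"
  shows "(mean \<theta> (k * r / \<theta>) - \<xi>)\<^sup>2 \<le> 4 * \<theta> + 4 * \<delta>\<^sup>2"
proof -
  let ?s = "k * r / \<theta>" and ?T = "mean \<theta> (k * r / \<theta>)"
  have "0 = moment \<theta> ?s (\<lambda>\<tau>. \<theta> * (1 - \<tau>\<^sup>2) + (\<tau> - \<xi>) * (k * r * (1 - \<tau>\<^sup>2) - (1 + \<theta>) * \<tau>))"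
    using moment_integration_by_parts[OF assms(1,2), of "k * r" \<xi>] by simp
  also have "\<dots> \<le> moment \<theta> ?s (\<lambda>\<tau>. \<theta> + \<delta>\<^sup>2 - ((?T - \<xi>)\<^sup>2 + 2 * (?T - \<xi>) * (\<tau> - ?T)) / 4)"
  proof (rule moment_mono)
    fix \<tau> :: real assume "\<tau> \<in> {-1..1}"
    hence \<tau>: "\<bar>\<tau>\<bar> \<le> 1" by auto
    hence sq: "\<tau>\<^sup>2 \<le> 1" by (simp add: abs_square_le_1)
    define x where "x = \<tau> - \<xi>"
    \<comment> \<open>\<open>y\<close> collects what remains when r is replaced by 1 and 1 +
      \<theta> by 1.\<close>
    define y where "y = k * (r - 1) * (1 - \<tau>\<^sup>2) - \<theta> * \<tau>"
    have eq: "x * (k * r * (1 - \<tau>\<^sup>2) - (1 + \<theta>) * \<tau>) = - (x\<^sup>2 * (1 + k * (\<xi> + \<tau>))) + x * y"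
    proof -
      have "k * r * (1 - \<tau>\<^sup>2) - (1 + \<theta>) * \<tau> = - (x * (1 + k * (\<xi> + \<tau>))) + y"
        using k(2) unfolding x_def y_def power2_eq_square
        by (simp add: algebra_simps)
      thus ?thesis by (simp only:) (simp add: power2_eq_square algebra_simps)
    qed
    have "\<bar>k * \<tau>\<bar> \<le> 1/2 * 1"
      unfolding abs_mult using k \<tau> by (intro mult_mono) auto
    \<comment> \<open>Coercivity: k \<xi> is nonnegative and k \<tau> is at least -1/2.\<close>
    hence "1/2 \<le> 1 + k * (\<xi> + \<tau>)" using k(3) unfolding distrib_left by linarith
    hence 1: "x\<^sup>2 * (1/2) \<le> x\<^sup>2 * (1 + k * (\<xi> + \<tau>))" by (intro mult_left_mono) auto
    have "\<bar>k * (r - 1) * (1 - \<tau>\<^sup>2)\<bar> \<le> \<bar>k\<bar> * \<bar>r - 1\<bar> * 1"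
      unfolding abs_mult using sq by (intro mult_left_mono) auto
    moreover have "\<bar>\<theta> * \<tau>\<bar> \<le> \<theta> * 1"
      unfolding abs_mult using \<tau> assms by (intro mult_mono) auto
    ultimately have "\<bar>y\<bar> \<le> \<delta>" unfolding y_def \<delta>_def by linarith
    hence "y\<^sup>2 \<le> \<delta>\<^sup>2" by (metis abs_ge_zero power2_abs power_mono)
    \<comment> \<open>Young's inequality with weight 1/4, so that half of the coercive term x^2 / 2
      survives.\<close>
    moreover have "0 \<le> (x / 2 - y)\<^sup>2" by simp
    ultimately have 2: "x * y \<le> x\<^sup>2 / 4 + \<delta>\<^sup>2"
      by (simp add: power2_eq_square algebra_simps)
    have 3: "\<theta> * (1 - \<tau>\<^sup>2) \<le> \<theta> * 1" using assms by (intro mult_left_mono) auto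
    \<comment> \<open>\<open>(\<tau> - \<xi>)\<^sup>2\<close> lies above its tangent at the mean, whose moment is that of the constant \<open>(?T - \<xi>)\<^sup>2\<close>.\<close>
    have "0 \<le> (\<tau> - ?T)\<^sup>2" by simp
    hence 4: "(?T - \<xi>)\<^sup>2 + 2 * (?T - \<xi>) * (\<tau> - ?T) \<le> x\<^sup>2"
      unfolding x_def by (simp add: power2_eq_square algebra_simps)
    have combine: "p + z \<le> \<theta> + d - q / 4"
      if "z = - b + c" "h * (1/2) \<le> b" "c \<le> h / 4 + d" "p \<le> \<theta> * 1" "q \<le> h"
      for p z b c d h q :: real
      using that by linarith
    show "\<theta> * (1 - \<tau>\<^sup>2) + (\<tau> - \<xi>) * (k * r * (1 - \<tau>\<^sup>2) - (1 + \<theta>) * \<tau>)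
      \<le> \<theta> + \<delta>\<^sup>2 - ((?T - \<xi>)\<^sup>2 + 2 * (?T - \<xi>) * (\<tau> - ?T)) / 4"
      unfolding x_def[symmetric] by (rule combine[OF eq 1 2 3 4])
  qed (use assms in \<open>auto intro!: continuous_intros\<close>)
  also have "(\<lambda>\<tau>. \<theta> + \<delta>\<^sup>2 - ((?T - \<xi>)\<^sup>2 + 2 * (?T - \<xi>) * (\<tau> - ?T)) / 4)
    = (\<lambda>\<tau>. (\<theta> + \<delta>\<^sup>2 - (?T - \<xi>)\<^sup>2 / 4 + (?T - \<xi>) * ?T / 2) + - ((?T - \<xi>) / 2) * \<tau>)"
    by (rule ext) (simp add: field_simps)
  also have "moment \<theta> ?s \<dots> = (\<theta> + \<delta>\<^sup>2 - (?T - \<xi>)\<^sup>2 / 4) * moment \<theta> ?s (\<lambda>\<tau>. 1)"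
    unfolding moment_affine[OF assms(1,2)] by (simp add: field_simps)
  finally show ?thesis
    using moment_1_pos[OF assms(1,2), of ?s] by (simp add: zero_le_mult_iff)
qed

section \<open>Convexity of \<open>ln N\<close>\<close>

text \<open>N t / N s is the expectation of exp ((t - s) \<tau>) under the density tilted by s, so
  Jensen's inequality for \<open>exp\<close> bounds it below by exp ((t - s)
  \<open>mean \<theta> s\<close>).\<close>

lemma ln_moment_1_diff_ge:
  assumes "0 < \<theta>" "\<theta> < 1"
  shows "(t - s) * mean \<theta> s \<le> ln (moment \<theta> t (\<lambda>\<tau>. 1)) - ln (moment \<theta> s (\<lambda>\<tau>. 1))"
proof -
  let ?T = "mean \<theta> s" and ?N = "\<lambda>s. moment \<theta> s (\<lambda>\<tau>. 1)"
  have pos: "0 < ?N s" "0 < ?N t" using moment_1_pos[OF assms] by auto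
  \<comment> \<open>The right-hand integrand is the tangent of \<open>exp\<close> at
    \<open>(t - s) * ?T\<close>; being affine in \<tau>, it has an exact moment.\<close>
  have "exp ((t - s) * ?T) * ?N s
      = moment \<theta> s (\<lambda>\<tau>. exp ((t - s) * ?T) * ((1 - (t - s) * ?T) + (t - s) * \<tau>))"
    unfolding moment_cmult moment_affine[OF assms] by simp
  also have "\<dots> \<le> moment \<theta> s (\<lambda>\<tau>. exp ((t - s) * \<tau>))"
  proof (rule moment_mono)
    fix \<tau> :: real
    have "1 + (t - s) * (\<tau> - ?T) \<le> exp ((t - s) * (\<tau> - ?T))" by (rule exp_ge_add_one_self)
    hence "exp ((t - s) * ?T) * (1 + (t - s) * (\<tau> - ?T))
        \<le> exp ((t - s) * ?T) * exp ((t - s) * (\<tau> - ?T))"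
      by (rule mult_left_mono) simp
    also have "\<dots> = exp ((t - s) * \<tau>)" by (simp flip: exp_add add: algebra_simps)
    finally show "exp ((t - s) * ?T) * ((1 - (t - s) * ?T) + (t - s) * \<tau>) \<le> exp ((t - s) * \<tau>)"
      by (simp add: algebra_simps)
  qed (use assms in \<open>auto intro!: continuous_intros\<close>)
  also have "\<dots> = ?N t"
    unfolding moment_def by (simp flip: exp_add mult.assoc add: algebra_simps)
  finally have "exp ((t - s) * ?T) * ?N s \<le> ?N t" .
  hence "ln (exp ((t - s) * ?T) * ?N s) \<le> ln (?N t)" using pos by simp
  thus ?thesis using pos by (simp add: ln_mult)
qed


section \<open>Elementary exponential inequalities\<close>

text \<open>Both bounds come from x \<le> exp x - 1 \<le> x exp x. They impose only an upper bound
  on x, because x will be \<theta> ln \<rho>, which is unbounded below near vacuum.\<close>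

lemma abs_exp_sub_1_le:
  fixes x w :: real
  assumes "x \<le> w" "0 \<le> w"
  shows "\<bar>exp x - 1\<bar> \<le> \<bar>x\<bar> * exp w"
    and "\<bar>exp x - 1 - x\<bar> \<le> x\<^sup>2 * exp w"
proof -
  have lower: "x \<le> exp x - 1" using exp_ge_add_one_self[of x] by linarith
  have "1 - x \<le> exp (- x)" using exp_ge_add_one_self[of "- x"] by simp
  hence "exp x * (1 - x) \<le> exp x * exp (- x)" by (intro mult_left_mono) auto
  also have "exp x * exp (- x) = 1" by (simp flip: exp_add)
  finally have upper: "exp x - 1 \<le> x * exp x" by (simp add: algebra_simps)
  have "\<bar>x\<bar> * 1 \<le> \<bar>x\<bar> * exp w" using assms by (intro mult_left_mono) auto
  moreover have "x * exp x \<le> \<bar>x\<bar> * exp w" using assms by (intro mult_mono) auto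
  ultimately show 1: "\<bar>exp x - 1\<bar> \<le> \<bar>x\<bar> * exp w" using lower upper by linarith
  have "\<bar>exp x - 1 - x\<bar> = exp x - 1 - x" using lower by simp
  also have "\<dots> \<le> x * (exp x - 1)" using upper by (simp add: algebra_simps)
  also have "\<dots> \<le> \<bar>x\<bar> * \<bar>exp x - 1\<bar>" by (metis abs_ge_self abs_mult)
  also have "\<dots> \<le> \<bar>x\<bar> * (\<bar>x\<bar> * exp w)" using 1 by (intro mult_left_mono) auto
  finally show "\<bar>exp x - 1 - x\<bar> \<le> x\<^sup>2 * exp w" by (simp add: power2_eq_square flip: mult.assoc)
qed

lemma le_sqrt_self:
  fixes \<theta> :: real
  assumes "0 < \<theta>" "\<theta> < 1"
  shows "\<theta> \<le> sqrt \<theta>"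
  by (rule real_le_rsqrt) (use assms in \<open>simp add: power2_eq_square mult_left_le\<close>)

lemma mult_le_of_less_1:
  fixes \<theta> L w :: real
  assumes "0 < \<theta>" "\<theta> < 1" "L \<le> w" "0 \<le> w"
  shows "\<theta> * L \<le> w"
proof -
  have "\<theta> * L \<le> \<theta> * w" using assms by (intro mult_left_mono) auto
  also have "\<dots> \<le> 1 * w" using assms by (intro mult_right_mono) auto
  finally show ?thesis by simp
qed

section \<open>Quantitative estimates of the mean and of the logarithmic ratio\<close>

text \<open>This is \<open>mean_sub_sq_le\<close> at r = exp (\<theta> L), which is \<rho>^\<theta>
  for L = ln \<rho>; both \<theta> and \<delta>^2 are at most Y^2.\<close>

lemma mean_sub_le:
  fixes \<theta> k \<xi> L w :: real
  assumes \<theta>: "0 < \<theta>" "\<theta> < 1"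
    and k: "\<bar>k\<bar> \<le> 1/2" "k * (1 - \<xi>\<^sup>2) = \<xi>" "0 \<le> k * \<xi>"
    and w: "L \<le> w" "0 \<le> w"
  shows "\<bar>mean \<theta> (k * exp (\<theta> * L) / \<theta>) - \<xi>\<bar> \<le> 4 * (sqrt \<theta> * (exp w * (1 + \<bar>L\<bar>)))"
proof -
  define Y where "Y = sqrt \<theta> * (exp w * (1 + \<bar>L\<bar>))"
  define \<delta> where "\<delta> = \<bar>k\<bar> * \<bar>exp (\<theta> * L) - 1\<bar> + \<theta>"
  have "1 * 1 \<le> exp w * (1 + \<bar>L\<bar>)" using w by (intro mult_mono) auto
  hence "sqrt \<theta> * 1 \<le> Y" unfolding Y_def using \<theta> by (intro mult_left_mono) auto
  hence sqrt: "sqrt \<theta> \<le> Y" by simp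
  hence Y: "0 \<le> Y" using \<theta> by (smt (verit) real_sqrt_ge_zero)
  have "\<theta> = (sqrt \<theta>)\<^sup>2" using \<theta> by simp
  also have "\<dots> \<le> Y\<^sup>2" using sqrt \<theta> by (intro power_mono) auto
  finally have 1: "\<theta> \<le> Y\<^sup>2" .
  have "\<bar>k\<bar> * \<bar>exp (\<theta> * L) - 1\<bar> \<le> 1 * (\<bar>\<theta> * L\<bar> * exp w)"
    using k(1) abs_exp_sub_1_le(1)[OF mult_le_of_less_1[OF \<theta> w] w(2)] by (intro mult_mono) auto
  also have "\<dots> = \<theta> * (\<bar>L\<bar> * exp w)" using \<theta> by (simp add: abs_mult)
  finally have "\<delta> \<le> \<theta> * (\<bar>L\<bar> * exp w) + \<theta> * 1" by (simp add: \<delta>_def)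
  also have "\<dots> \<le> \<theta> * (\<bar>L\<bar> * exp w) + \<theta> * exp w"
    using \<theta> w by (intro add_left_mono mult_left_mono) auto
  also have "\<dots> = \<theta> * (exp w * (1 + \<bar>L\<bar>))" by (simp add: algebra_simps)
  also have "\<dots> \<le> Y" unfolding Y_def using le_sqrt_self[OF \<theta>] by (intro mult_right_mono) auto
  finally have "\<delta> \<le> Y" .
  moreover have "0 \<le> \<delta>" unfolding \<delta>_def using \<theta> by simp
  ultimately have 2: "\<delta>\<^sup>2 \<le> Y\<^sup>2" by (intro power_mono) auto
  have "(mean \<theta> (k * exp (\<theta> * L) / \<theta>) - \<xi>)\<^sup>2 \<le> 4 * \<theta> + 4 * \<delta>\<^sup>2"
    unfolding \<delta>_def by (rule mean_sub_sq_le[OF \<theta> k])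
  \<comment> \<open>The sum is at most 8 Y^2; 16 is a convenient perfect square.\<close>
  also have "\<dots> \<le> 16 * Y\<^sup>2"
    using 1 2 zero_le_power2[of Y] by linarith
  also have "\<dots> = (4 * Y)\<^sup>2" by (simp add: power_mult_distrib)
  finally have "\<bar>mean \<theta> (k * exp (\<theta> * L) / \<theta>) - \<xi>\<bar> \<le> \<bar>4 * Y\<bar>"
    by (simp only: abs_le_square_iff)
  thus ?thesis using Y by (simp add: Y_def)
qed

text \<open>Logarithm of N (k \<rho>^\<theta> / \<theta>) / N (k / \<theta>) for \<rho> = exp L. Its
  isothermal counterpart is k \<xi> L.\<close>

definition log_ratio :: "real \<Rightarrow> real \<Rightarrow> real \<Rightarrow> real" where
  "log_ratio \<theta> k L = ln (moment \<theta> (k * exp (\<theta> * L) / \<theta>) (\<lambda>\<tau>. 1)) - ln (moment \<theta> (k / \<theta>) (\<lambda>\<tau>. 1))"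

text \<open>Tangent inequalities of the convex function \<open>ln N\<close> at the two endpoints;
  \<open>D\<close> is the increment of the tilt and may have either sign.\<close>

lemma log_ratio_between:
  fixes \<theta> k L :: real
  assumes "0 < \<theta>" "\<theta> < 1"
  defines "D \<equiv> k * ((exp (\<theta> * L) - 1) / \<theta>)"
  shows "D * mean \<theta> (k / \<theta>) \<le> log_ratio \<theta> k L"
    and "log_ratio \<theta> k L \<le> D * mean \<theta> (k * exp (\<theta> * L) / \<theta>)"
proof -
  have D: "k * exp (\<theta> * L) / \<theta> - k / \<theta> = D"
    by (simp add: D_def right_diff_distrib diff_divide_distrib)
  show "D * mean \<theta> (k / \<theta>) \<le> log_ratio \<theta> k L"
    using ln_moment_1_diff_ge[OF assms(1,2), where s = "k / \<theta>" and t = "k * exp (\<theta> * L) / \<theta>"]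
    unfolding D log_ratio_def .
  have "- D * mean \<theta> (k * exp (\<theta> * L) / \<theta>) \<le> - log_ratio \<theta> k L"
    using ln_moment_1_diff_ge[OF assms(1,2), where t = "k / \<theta>" and s = "k * exp (\<theta> * L) / \<theta>"]
    unfolding D[symmetric] log_ratio_def by simp
  thus "log_ratio \<theta> k L \<le> D * mean \<theta> (k * exp (\<theta> * L) / \<theta>)" by simp
qed

text \<open>Slopes of \<open>ln N\<close> are at most 1 in modulus. This bound is linear in L near
  vacuum, where the quadratic bound of \<open>log_ratio_sub_le\<close> could not control the size of
  the density.\<close>

lemma abs_log_ratio_le:
  fixes \<theta> k L :: real
  assumes "0 < \<theta>" "\<theta> < 1"
  shows "\<bar>log_ratio \<theta> k L\<bar> \<le> \<bar>k\<bar> * (\<bar>exp (\<theta> * L) - 1\<bar> / \<theta>)"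
proof -
  define D where "D = k * ((exp (\<theta> * L) - 1) / \<theta>)"
  have le: "\<bar>D * mean \<theta> s\<bar> \<le> \<bar>D\<bar>" for s
    unfolding abs_mult using abs_mean_le_1[OF assms, of s] by (simp add: mult_left_le)
  have "\<bar>log_ratio \<theta> k L\<bar> \<le> \<bar>D\<bar>"
    using log_ratio_between[OF assms, of k L, folded D_def]
      le[of "k / \<theta>"] le[of "k * exp (\<theta> * L) / \<theta>"] by linarith
  thus ?thesis using assms by (simp add: D_def abs_mult)
qed

text \<open>The ratio lies between D times two means, each \<xi> + O(sqrt \<theta> Y); replacing D
  \<xi> by k \<xi> L then costs a second-order remainder of \<open>exp\<close>. The two errors
  contribute 2 and 1 to the constant 3.\<close>

lemma log_ratio_sub_le:
  fixes \<theta> k \<xi> L w :: real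
  assumes \<theta>: "0 < \<theta>" "\<theta> < 1"
    and k: "\<bar>k\<bar> \<le> 1/2" "k * (1 - \<xi>\<^sup>2) = \<xi>" "0 \<le> k * \<xi>"
    and \<xi>: "\<bar>\<xi>\<bar> \<le> 1"
    and w: "L \<le> w" "0 \<le> w"
  shows "\<bar>log_ratio \<theta> k L - k * \<xi> * L\<bar> \<le> 3 * (sqrt \<theta> * (exp w * (1 + \<bar>L\<bar>))\<^sup>2)"
proof -
  define Y where "Y = exp w * (1 + \<bar>L\<bar>)"
  define D where "D = k * ((exp (\<theta> * L) - 1) / \<theta>)"
  have L: "0 \<le> \<bar>L\<bar>" "\<bar>L\<bar> * exp w \<le> Y" "1 \<le> exp w" using w by (auto simp: Y_def algebra_simps)
  have Y: "\<bar>L\<bar> \<le> Y"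
    using L w by (smt (verit) mult_left_le mult_le_cancel_left1)
  have x: "\<theta> * L \<le> w" by (rule mult_le_of_less_1[OF \<theta> w])
  have "\<bar>(exp (\<theta> * L) - 1) / \<theta>\<bar> \<le> \<bar>\<theta> * L\<bar> * exp w / \<theta>"
    using divide_right_mono[OF abs_exp_sub_1_le(1)[OF x w(2)], of \<theta>] \<theta> by simp
  hence "\<bar>D\<bar> \<le> 1/2 * (\<bar>\<theta> * L\<bar> * exp w / \<theta>)"
    unfolding D_def abs_mult[of k] using k(1) by (intro mult_mono) auto
  also have "\<dots> = 1/2 * (\<bar>L\<bar> * exp w)" using \<theta> by (simp add: abs_mult)
  also have "\<dots> \<le> 1/2 * Y" using L by simp
  finally have D: "\<bar>D\<bar> \<le> 1/2 * Y" .
  have near: "\<bar>D * t - D * \<xi>\<bar> \<le> 2 * (sqrt \<theta> * Y\<^sup>2)" if "\<bar>t - \<xi>\<bar> \<le> 4 * (sqrt \<theta> * Y)" for t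
  proof -
    have "\<bar>D * t - D * \<xi>\<bar> = \<bar>D\<bar> * \<bar>t - \<xi>\<bar>" by (metis abs_mult right_diff_distrib)
    also have "\<dots> \<le> (1/2 * Y) * (4 * (sqrt \<theta> * Y))"
      using D that Y L by (intro mult_mono) auto
    finally show ?thesis by (simp add: power2_eq_square algebra_simps)
  qed
  \<comment> \<open>The untransformed tilt \<open>k / \<theta>\<close> is the case L = 0.\<close>
  have "\<bar>mean \<theta> (k / \<theta>) - \<xi>\<bar> \<le> 4 * (sqrt \<theta> * exp w)"
    using mean_sub_le[OF \<theta> k, of 0 w] w by simp
  also have "\<dots> \<le> 4 * (sqrt \<theta> * Y)"
    using \<theta> by (simp add: Y_def)
  finally have 1: "\<bar>D * mean \<theta> (k / \<theta>) - D * \<xi>\<bar> \<le> 2 * (sqrt \<theta> * Y\<^sup>2)" by (rule near)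
  have 2: "\<bar>D * mean \<theta> (k * exp (\<theta> * L) / \<theta>) - D * \<xi>\<bar> \<le> 2 * (sqrt \<theta> * Y\<^sup>2)"
    by (rule near) (use mean_sub_le[OF \<theta> k w] in \<open>simp add: Y_def\<close>)
  have "D * \<xi> - k * \<xi> * L = k * \<xi> * ((exp (\<theta> * L) - 1 - \<theta> * L) / \<theta>)"
    unfolding D_def using \<theta> by (simp add: field_simps)
  hence "\<bar>D * \<xi> - k * \<xi> * L\<bar> = \<bar>k * \<xi>\<bar> * (\<bar>exp (\<theta> * L) - 1 - \<theta> * L\<bar> / \<theta>)"
    using \<theta> by (simp add: abs_mult)
  also have "\<dots> \<le> 1 * ((\<theta> * L)\<^sup>2 * exp w / \<theta>)"
  proof (intro mult_mono divide_right_mono abs_exp_sub_1_le x w)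
    show "\<bar>k * \<xi>\<bar> \<le> 1" unfolding abs_mult using k(1) \<xi> mult_mono[of "\<bar>k\<bar>" 1 "\<bar>\<xi>\<bar>" 1] by simp
  qed (use \<theta> in auto)
  also have "\<dots> = \<theta> * (\<bar>L\<bar> * (\<bar>L\<bar> * exp w))" using \<theta> by (simp add: power2_eq_square)
  also have "\<dots> \<le> sqrt \<theta> * (Y * Y)"
    using le_sqrt_self[OF \<theta>] L Y \<theta> by (intro mult_mono) auto
  finally have 3: "\<bar>D * \<xi> - k * \<xi> * L\<bar> \<le> sqrt \<theta> * Y\<^sup>2" by (simp add: power2_eq_square)
  show ?thesis
    using 1 2 3 log_ratio_between[OF \<theta>, of k L, folded D_def] unfolding Y_def[symmetric] by linarith
qed

section \<open>Absorbing powers of the logarithm and comparing exponentials\<close>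

text \<open>Cube y \<le> exp y at y = \<epsilon> (1 + x) / 3. The third power is the one needed: two
  factors 1 + \<bar>L\<bar> come from \<open>log_ratio_sub_le\<close> and one from the velocity m /
  \<rho>.\<close>

lemma cube_mult_exp_le:
  fixes x \<epsilon> :: real
  assumes "0 \<le> x" "0 < \<epsilon>"
  shows "(1 + x) ^ 3 * exp (- \<epsilon> * x) \<le> (3 / \<epsilon>) ^ 3 * exp \<epsilon>"
proof -
  define y where "y = \<epsilon> * (1 + x) / 3"
  have "y \<le> exp y" using exp_ge_add_one_self[of y] by linarith
  hence "y ^ 3 \<le> exp y ^ 3" using assms by (intro power_mono) (auto simp: y_def)
  also have "exp y ^ 3 = exp (\<epsilon> + \<epsilon> * x)"
    by (simp add: y_def field_simps flip: exp_of_nat_mult)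
  finally have "(3 / \<epsilon>) ^ 3 * y ^ 3 * exp (- \<epsilon> * x) \<le> (3 / \<epsilon>) ^ 3 * exp (\<epsilon> + \<epsilon> * x) * exp (- \<epsilon> * x)"
    using assms by (intro mult_right_mono mult_left_mono) auto
  moreover have "(3 / \<epsilon>) ^ 3 * y ^ 3 = (1 + x) ^ 3"
  proof -
    have "(3 / \<epsilon>) * y = 1 + x" using assms by (simp add: y_def)
    thus ?thesis by (metis power_mult_distrib)
  qed
  ultimately show ?thesis by (simp add: mult.assoc flip: exp_add)
qed

lemma abs_exp_diff_le:
  fixes x y z :: real
  assumes "x \<le> z" "y \<le> z"
  shows "\<bar>exp x - exp y\<bar> \<le> exp z * \<bar>x - y\<bar>"
proof -
  have *: "exp x - exp y \<le> exp z * \<bar>x - y\<bar>" if "x \<le> z" for x y :: real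
  proof -
    have "exp x * (1 + (y - x)) \<le> exp x * exp (y - x)"
      by (intro mult_left_mono exp_ge_add_one_self) auto
    also have "exp x * exp (y - x) = exp y" by (simp flip: exp_add)
    finally have "exp x - exp y \<le> exp x * (x - y)" by (simp add: algebra_simps)
    also have "\<dots> \<le> exp x * \<bar>x - y\<bar>" by (intro mult_left_mono) auto
    also have "\<dots> \<le> exp z * \<bar>x - y\<bar>" using that by (intro mult_right_mono) auto
    finally show ?thesis .
  qed
  show ?thesis using *[of x y] *[of y x] assms by (simp add: abs_minus_commute abs_le_iff)
qed


section \<open>Exponential form of the entropy pairs\<close>

text \<open>The factor exp (k m / \<rho>) leaves the integrals, and moments at tilt k
  \<rho>^\<theta> / \<theta> remain. The velocity factor in the flux is affine in \<tau>, so
  integration replaces \<tau> by its mean.\<close>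

lemma eta_isentropic_eq:
  fixes \<theta> \<xi> \<rho> m :: real
  assumes \<theta>: "0 < \<theta>" "\<theta> < 1" and \<rho>: "0 < \<rho>"
  defines "k \<equiv> \<xi> / (1 - \<xi>\<^sup>2)"
  shows "eta_isentropic \<theta> \<xi> \<rho> m = exp (ln \<rho> + k * (m / \<rho>) + log_ratio \<theta> k (ln \<rho>))"
    and "q_isentropic \<theta> \<xi> \<rho> m =
      (m / \<rho> + exp (\<theta> * ln \<rho>) * mean \<theta> (k * exp (\<theta> * ln \<rho>) / \<theta>)) * eta_isentropic \<theta> \<xi> \<rho> m"
proof -
  let ?r = "exp (\<theta> * ln \<rho>)"
  let ?N = "\<lambda>s. moment \<theta> s (\<lambda>\<tau>. 1)"
  have powr: "\<rho> powr \<theta> = ?r" using \<rho> by (simp add: powr_def)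
  have norm: "normalization_const \<theta> \<xi> = ?N (k / \<theta>)"
    unfolding normalization_const_def moment_def k_def by (simp add: mult.commute)
  have split: "exp (k * (m / \<rho> + ?r / \<theta> * \<tau>)) = exp (k * (m / \<rho>)) * exp (k * ?r / \<theta> * \<tau>)" for \<tau>
    by (simp add: distrib_left flip: exp_add)
  have "(\<integral>\<tau>. exp (k * (m / \<rho> + ?r / \<theta> * \<tau>)) * chi \<theta> \<tau> \<partial>lborel)
      = exp (k * (m / \<rho>)) * ?N (k * ?r / \<theta>)"
    unfolding split moment_def by (simp add: mult.assoc)
  hence 1: "eta_isentropic \<theta> \<xi> \<rho> m = \<rho> * (exp (k * (m / \<rho>)) * ?N (k * ?r / \<theta>)) / ?N (k / \<theta>)"
    using \<rho> by (simp add: eta_isentropic_def norm powr flip: k_def)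
  have "(\<integral>\<tau>. (m / \<rho> + ?r * \<tau>) * exp (k * (m / \<rho> + ?r / \<theta> * \<tau>)) * chi \<theta> \<tau> \<partial>lborel)
      = exp (k * (m / \<rho>)) * moment \<theta> (k * ?r / \<theta>) (\<lambda>\<tau>. m / \<rho> + ?r * \<tau>)"
    unfolding split moment_def integral_mult_right_zero[symmetric]
    by (rule Bochner_Integration.integral_cong) (simp_all add: mult_ac)
  hence 2: "q_isentropic \<theta> \<xi> \<rho> m = \<rho> * (exp (k * (m / \<rho>)) *
      ((m / \<rho> + ?r * mean \<theta> (k * ?r / \<theta>)) * ?N (k * ?r / \<theta>))) / ?N (k / \<theta>)"
    using \<rho> by (simp add: q_isentropic_def norm powr moment_affine[OF \<theta>] flip: k_def)
  show "q_isentropic \<theta> \<xi> \<rho> m =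
      (m / \<rho> + ?r * mean \<theta> (k * ?r / \<theta>)) * eta_isentropic \<theta> \<xi> \<rho> m"
    unfolding 1 2 by simp
  show "eta_isentropic \<theta> \<xi> \<rho> m = exp (ln \<rho> + k * (m / \<rho>) + log_ratio \<theta> k (ln \<rho>))"
    unfolding 1 log_ratio_def exp_add exp_diff
    using \<rho> moment_1_pos[OF \<theta>, of "k / \<theta>"] moment_1_pos[OF \<theta>, of "k * ?r / \<theta>"] by simp
qed

lemma eta_isothermal_eq:
  fixes \<xi> \<rho> m :: real
  assumes "\<bar>\<xi>\<bar> < 1" and \<rho>: "0 < \<rho>"
  defines "k \<equiv> \<xi> / (1 - \<xi>\<^sup>2)"
  shows "eta_isothermal \<xi> \<rho> m = exp (ln \<rho> + k * (m / \<rho>) + k * \<xi> * ln \<rho>)"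
proof -
  have "1 - \<xi>\<^sup>2 \<noteq> 0" using assms(1) abs_square_less_1[of \<xi>] by linarith
  \<comment> \<open>Splits the isothermal power into \<rho>, common to both densities, and \<rho>^(k
    \<xi>).\<close>
  hence "1 / (1 - \<xi>\<^sup>2) = 1 + k * \<xi>"
    by (simp add: k_def power2_eq_square divide_simps)
  thus ?thesis using \<rho>
    by (simp add: eta_isothermal_def powr_def algebra_simps flip: k_def exp_add)
qed

section \<open>Decay at vacuum and the pointwise estimate\<close>

text \<open>For L \<le> 0 the velocity and \<open>x\<close> each cost at most K \<bar>L\<bar>
  against L = -\<bar>L\<bar>, leaving the rate 1 - 2 K; a factor above 1 in the bound on
  \<open>x\<close> would spoil this rate. For L > 0 every term is bounded through L \<le> w.\<close>

lemma exponent_le: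
  fixes L u x k K w :: real
  assumes u: "\<bar>u\<bar> \<le> \<bar>L\<bar> + w" and L: "L \<le> w" and w: "0 \<le> w"
    and k: "\<bar>k\<bar> \<le> K" "K < 1/2"
    and x: "\<bar>x\<bar> \<le> \<bar>k\<bar> * \<bar>L\<bar> * (if L \<le> 0 then 1 else exp w)"
  shows "L + k * u + x \<le> - (1 - 2 * K) * \<bar>L\<bar> + (3 * w + w * exp w)"
proof (cases "L \<le> 0")
  case True
  have "k * u \<le> K * (\<bar>L\<bar> + w)"
  proof -
    have "k * u \<le> \<bar>k\<bar> * \<bar>u\<bar>" by (metis abs_ge_self abs_mult)
    also have "\<dots> \<le> K * (\<bar>L\<bar> + w)" using u k by (intro mult_mono) auto
    finally show ?thesis .
  qed
  moreover have "\<bar>k\<bar> * \<bar>L\<bar> \<le> K * \<bar>L\<bar>" using k by (intro mult_right_mono) auto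
  hence "x \<le> K * \<bar>L\<bar>" using x True by simp
  moreover have "K * w \<le> 3 * w" "0 \<le> w * exp w" using k w by (auto intro: mult_right_mono)
  ultimately have "L + k * u + x \<le> L + (K * \<bar>L\<bar> + K * w) + K * \<bar>L\<bar>" "K * w \<le> 3 * w + w * exp w"
    by (auto simp: distrib_left)
  moreover have "- (1 - 2 * K) * \<bar>L\<bar> = L + K * \<bar>L\<bar> + K * \<bar>L\<bar>"
    using True by (simp add: algebra_simps)
  ultimately show ?thesis by linarith
next
  case False
  hence aL: "\<bar>L\<bar> = L" "0 \<le> L" by auto
  have K: "0 \<le> K" using k by linarith
  have "k * u \<le> \<bar>k\<bar> * \<bar>u\<bar>" by (metis abs_ge_self abs_mult)
  also have "\<dots> \<le> 1/2 * (2 * w)" using u k aL L w by (intro mult_mono) auto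
  finally have 1: "k * u \<le> w" by simp
  have "\<bar>x\<bar> \<le> (\<bar>k\<bar> * L) * exp w" using x False by simp
  also have "\<dots> \<le> (1 * w) * exp w" using k L aL w by (intro mult_mono) auto
  finally have 2: "x \<le> w * exp w" by simp
  \<comment> \<open>The decay term is present for L > 0 too; compensating it uses the third w in
    \<open>3 * w\<close>.\<close>
  have "(1 - 2 * K) * L \<le> 1 * w" using K aL L w by (intro mult_mono) auto
  thus ?thesis using 1 2 L aL by linarith
qed

lemma entropy_pair_diff_le:
  fixes \<theta> \<xi> \<rho> m w K :: real
  assumes \<theta>: "0 < \<theta>" "\<theta> < 1" and w: "0 \<le> w"
    and \<xi>: "\<bar>\<xi>\<bar> < 1" and K: "\<bar>\<xi> / (1 - \<xi>\<^sup>2)\<bar> \<le> K" "K < 1/2"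
    and \<rho>: "0 < \<rho>" and adm: "admissible_state w \<rho> m"
  shows "\<bar>eta_isentropic \<theta> \<xi> \<rho> m - eta_isothermal \<xi> \<rho> m\<bar>
      + \<bar>q_isentropic \<theta> \<xi> \<rho> m - q_isothermal \<xi> \<rho> m\<bar>
    \<le> (exp w)\<^sup>2 * (3 * w + 11) * exp (3 * w + w * exp w) * ((3 / (1 - 2 * K)) ^ 3 * exp (1 - 2 * K))
      * sqrt \<theta>"
proof -
  define k where "k = \<xi> / (1 - \<xi>\<^sup>2)"
  define L where "L = ln \<rho>"
  define u where "u = m / \<rho>"
  define r where "r = exp (\<theta> * L)"
  define T where "T = mean \<theta> (k * r / \<theta>)"
  define A where "A = log_ratio \<theta> k L"
  define B where "B = k * \<xi> * L"
  define G where "G = exp w"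
  define E where "E = - (1 - 2 * K) * \<bar>L\<bar> + (3 * w + w * exp w)"
  define l where "l = 1 + \<bar>L\<bar>"
  have l: "1 \<le> l" "\<bar>L\<bar> \<le> l" by (auto simp: l_def)
  have G: "1 \<le> G" using w by (simp add: G_def)
  have "0 < 1 - \<xi>\<^sup>2" using \<xi> by (simp add: abs_square_less_1)
  moreover have "k * \<xi> = \<xi>\<^sup>2 / (1 - \<xi>\<^sup>2)" by (simp add: k_def power2_eq_square)
  moreover have "\<bar>k\<bar> \<le> K" "\<bar>k\<bar> \<le> 1/2" using K unfolding k_def by linarith+
  ultimately have k: "\<bar>k\<bar> \<le> K" "\<bar>k\<bar> \<le> 1/2" "k * (1 - \<xi>\<^sup>2) = \<xi>" "0 \<le> k * \<xi>"
    by (simp_all add: k_def)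
  have "ln \<rho> \<le> ln (exp w)"
    using adm \<rho> by (subst ln_le_cancel_iff) (auto simp: admissible_state_def)
  hence Lw: "L \<le> w" by (simp add: L_def)
  have u: "\<bar>u\<bar> \<le> \<bar>L\<bar> + w"
    using adm \<rho> by (simp add: u_def L_def admissible_state_def field_simps)
  have x: "\<bar>r - 1\<bar> \<le> \<theta> * (\<bar>L\<bar> * G)"
    using abs_exp_sub_1_le(1)[OF mult_le_of_less_1[OF \<theta> Lw w] w] \<theta>
    by (simp add: r_def G_def abs_mult)
  have A_bound: "\<bar>A\<bar> \<le> \<bar>k\<bar> * \<bar>L\<bar> * (if L \<le> 0 then 1 else exp w)"
  proof -
    have "\<bar>A\<bar> \<le> \<bar>k\<bar> * (\<bar>r - 1\<bar> / \<theta>)" unfolding A_def r_def by (rule abs_log_ratio_le[OF \<theta>])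
    also have "\<bar>r - 1\<bar> / \<theta> \<le> \<bar>L\<bar> * (if L \<le> 0 then 1 else exp w)"
    proof (cases "L \<le> 0")
      case True
      hence "\<theta> * L \<le> 0" using \<theta> by (simp add: mult_le_0_iff)
      \<comment> \<open>Here the upper bound on \<theta> L is 0 instead of w, so the constant is exp
        0 = 1.\<close>
      from abs_exp_sub_1_le(1)[OF this] show ?thesis
        using \<theta> True by (simp add: r_def abs_mult field_simps)
    next
      case False
      thus ?thesis using x \<theta> by (simp add: G_def field_simps)
    qed
    finally show ?thesis by (simp add: mult.assoc mult_left_mono)
  qed
  have B_bound: "\<bar>B\<bar> \<le> \<bar>k\<bar> * \<bar>L\<bar> * (if L \<le> 0 then 1 else exp w)"
  proof -
    have "\<bar>B\<bar> = (\<bar>k\<bar> * \<bar>L\<bar>) * \<bar>\<xi>\<bar>" by (simp add: B_def abs_mult)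
    also have "\<dots> \<le> (\<bar>k\<bar> * \<bar>L\<bar>) * (if L \<le> 0 then 1 else exp w)"
      using \<xi> w by (intro mult_left_mono) (auto intro: order_trans[of _ 1])
    finally show ?thesis .
  qed
  define \<eta> where "\<eta> = exp (L + k * u + A)"
  define \<eta>' where "\<eta>' = exp (L + k * u + B)"
  have \<eta>: "eta_isentropic \<theta> \<xi> \<rho> m = \<eta>" "eta_isothermal \<xi> \<rho> m = \<eta>'"
    using eta_isentropic_eq(1)[OF \<theta> \<rho>, of \<xi> m] eta_isothermal_eq[OF \<xi> \<rho>, of m]
    by (simp_all add: \<eta>_def \<eta>'_def A_def B_def L_def k_def u_def)
  have q: "q_isentropic \<theta> \<xi> \<rho> m = (u + r * T) * \<eta>" "q_isothermal \<xi> \<rho> m = (u + \<xi>) * \<eta>'"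
    using eta_isentropic_eq(2)[OF \<theta> \<rho>, of \<xi> m] \<rho>
    by (simp_all add: \<eta> u_def r_def L_def T_def k_def q_isothermal_def)
  have A_le: "L + k * u + A \<le> E" and B_le: "L + k * u + B \<le> E"
    unfolding E_def using exponent_le[OF u Lw w k(1) K(2)] A_bound B_bound by blast+
  have AB: "\<bar>A - B\<bar> \<le> 3 * (sqrt \<theta> * (G * l)\<^sup>2)"
    unfolding A_def B_def G_def l_def using \<xi> by (intro log_ratio_sub_le \<theta> k Lw w) auto
  have "\<bar>\<eta> - \<eta>'\<bar> \<le> exp E * \<bar>A - B\<bar>"
    using abs_exp_diff_le[OF A_le B_le] by (simp add: \<eta>_def \<eta>'_def)
  also have "\<dots> \<le> exp E * (3 * (sqrt \<theta> * (G * l)\<^sup>2))" using AB by (intro mult_left_mono) auto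
  finally have \<eta>_diff: "\<bar>\<eta> - \<eta>'\<bar> \<le> exp E * (3 * (sqrt \<theta> * (G * l)\<^sup>2))" .
  \<comment> \<open>The constant is 1 + 4: replacing r by 1, then the mean by \<xi>.\<close>
  have rT: "\<bar>r * T - \<xi>\<bar> \<le> 5 * (sqrt \<theta> * (G * l))"
  proof -
    have "\<bar>r * T - \<xi>\<bar> \<le> \<bar>(r - 1) * T\<bar> + \<bar>T - \<xi>\<bar>" by (simp add: algebra_simps)
    moreover have "\<bar>(r - 1) * T\<bar> \<le> \<bar>r - 1\<bar> * 1"
      unfolding abs_mult T_def using abs_mean_le_1[OF \<theta>] by (intro mult_left_mono) auto
    moreover have "\<theta> * (\<bar>L\<bar> * G) \<le> sqrt \<theta> * (l * G)"
      using le_sqrt_self[OF \<theta>] \<theta> l G by (intro mult_mono) auto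
    moreover have "\<bar>T - \<xi>\<bar> \<le> 4 * (sqrt \<theta> * (G * l))"
      unfolding T_def r_def G_def l_def by (rule mean_sub_le[OF \<theta> k(2-) Lw w])
    ultimately show ?thesis using x by (simp add: mult.commute)
  qed
  have "\<bar>u + \<xi>\<bar> \<le> (w + 1) * l"
  proof -
    have "\<bar>u + \<xi>\<bar> \<le> \<bar>L\<bar> + w + 1" using u \<xi> by linarith
    also have "\<dots> \<le> (w + 1) * l" using w by (simp add: l_def algebra_simps)
    finally show ?thesis .
  qed
  hence u\<xi>: "1 + \<bar>u + \<xi>\<bar> \<le> (w + 2) * l" using l by (simp add: algebra_simps)
  \<comment> \<open>The flux difference splits into a density error weighted by the isothermal
    velocity and a velocity error weighted by the density.\<close>
  have "(u + r * T) * \<eta> - (u + \<xi>) * \<eta>' = (u + \<xi>) * (\<eta> - \<eta>') + (r * T - \<xi>) * \<eta>"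
    by (simp add: algebra_simps)
  hence "\<bar>\<eta> - \<eta>'\<bar> + \<bar>(u + r * T) * \<eta> - (u + \<xi>) * \<eta>'\<bar>
      \<le> \<bar>\<eta> - \<eta>'\<bar> + (\<bar>u + \<xi>\<bar> * \<bar>\<eta> - \<eta>'\<bar> + \<bar>r * T - \<xi>\<bar> * \<eta>)"
    using abs_triangle_ineq[of "(u + \<xi>) * (\<eta> - \<eta>')" "(r * T - \<xi>) * \<eta>"]
    by (simp add: abs_mult \<eta>_def)
  also have "\<dots> = (1 + \<bar>u + \<xi>\<bar>) * \<bar>\<eta> - \<eta>'\<bar> + \<bar>r * T - \<xi>\<bar> * \<eta>"
    by (simp add: algebra_simps)
  also have "\<dots> \<le> ((w + 2) * l) * (exp E * (3 * (sqrt \<theta> * (G * l)\<^sup>2)))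
      + (5 * (sqrt \<theta> * (G\<^sup>2 * l ^ 3))) * exp E"
  proof (intro add_mono mult_mono u\<xi> \<eta>_diff)
    \<comment> \<open>The velocity error is weakened from G l to G^2 l^3 so that both terms share
      one factor.\<close>
    have "G * 1 \<le> G * G" "l * 1 \<le> l * (l * l)"
      using G l by (auto intro!: mult_left_mono mult_ge1_I)
    hence "G * l \<le> G\<^sup>2 * l ^ 3"
      unfolding power2_eq_square power3_eq_cube using G l by (intro mult_mono) (auto simp: mult.assoc)
    hence "sqrt \<theta> * (G * l) \<le> sqrt \<theta> * (G\<^sup>2 * l ^ 3)" using \<theta> by (intro mult_left_mono) auto
    thus "\<bar>r * T - \<xi>\<bar> \<le> 5 * (sqrt \<theta> * (G\<^sup>2 * l ^ 3))" using rT by linarith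
    show "\<eta> \<le> exp E" using A_le by (simp add: \<eta>_def)
  qed (use w l G \<theta> in \<open>auto simp: \<eta>_def\<close>)
  \<comment> \<open>The constant is 3 (w + 2) + 5 = 3 w + 11.\<close>
  also have "\<dots> = G\<^sup>2 * (3 * w + 11) * (l ^ 3 * exp E) * sqrt \<theta>"
    by (simp add: power2_eq_square power3_eq_cube algebra_simps)
  also have "l ^ 3 * exp E = exp (3 * w + w * exp w) * (l ^ 3 * exp (- (1 - 2 * K) * \<bar>L\<bar>))"
    unfolding E_def exp_add by (simp only: mult_ac)
  also have "G\<^sup>2 * (3 * w + 11) * \<dots> * sqrt \<theta>
      \<le> G\<^sup>2 * (3 * w + 11) *
        (exp (3 * w + w * exp w) * ((3 / (1 - 2 * K)) ^ 3 * exp (1 - 2 * K))) * sqrt \<theta>"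
    unfolding l_def using K w \<theta>
    by (intro mult_right_mono mult_left_mono cube_mult_exp_le) auto
  finally show ?thesis unfolding \<eta> q G_def by (simp only: mult.assoc)
qed

section \<open>Uniformity in \<xi> and passage to almost every point\<close>

theorem proposition5p1:
  fixes w\<^sub>0 a b :: real
  assumes "w\<^sub>0 > 0"
    and "a \<le> b"
    and "{a..b} \<subseteq> {- sqrt 2 + 1<..<sqrt 2 - 1}"
  shows "\<exists>C>0. \<forall>\<theta>\<^sub>0\<in>{0<..<1}. \<forall>\<theta>\<in>{0<..\<theta>\<^sub>0}. \<forall>\<rho> m :: real \<times> real \<Rightarrow> real.
    (AE p in lebesgue_on half_plane. admissible_state w\<^sub>0 (\<rho> p) (m p)) \<longrightarrow>
    (AE p in lebesgue_on half_plane. \<forall>\<xi>\<in>{a..b}.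
       \<bar>eta_isentropic \<theta> \<xi> (\<rho> p) (m p) - eta_isothermal \<xi> (\<rho> p) (m p)\<bar>
     + \<bar>q_isentropic \<theta> \<xi> (\<rho> p) (m p) - q_isothermal \<xi> (\<rho> p) (m p)\<bar> \<le> C * sqrt \<theta>)"
proof -
  \<comment> \<open>\<open>c\<close> is the largest modulus in the interval; \<bar>\<xi>\<bar> / (1
    - \<xi>^2) increases with \<bar>\<xi>\<bar>, so its value \<open>K\<close> at \<open>c\<close>
    bounds every \<bar>k\<bar>.\<close>
  define c where "c = max \<bar>a\<bar> \<bar>b\<bar>"
  define K where "K = c / (1 - c\<^sup>2)"
  have "a \<in> {- sqrt 2 + 1<..<sqrt 2 - 1}" "b \<in> {- sqrt 2 + 1<..<sqrt 2 - 1}"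
    using assms(2,3) by auto
  hence c: "0 \<le> c" "c + 1 < sqrt 2" by (auto simp: c_def)
  \<comment> \<open>Expanded, this is 2 c < 1 - c^2, which is K < 1/2.\<close>
  have "(c + 1)\<^sup>2 < (sqrt 2)\<^sup>2" using c by (intro power_strict_mono) auto
  hence c2: "2 * c < 1 - c\<^sup>2" by (simp add: power2_eq_square algebra_simps)
  hence K: "K < 1/2" using c by (simp add: K_def field_simps)
  have "c\<^sup>2 < 1" using c c2 by linarith
  hence c1: "c < 1" using c by (simp add: abs_square_less_1)
  have \<xi>: "\<bar>\<xi>\<bar> < 1" "\<bar>\<xi> / (1 - \<xi>\<^sup>2)\<bar> \<le> K" if "\<xi> \<in> {a..b}" for \<xi>
  proof -
    have le: "\<bar>\<xi>\<bar> \<le> c" using that by (auto simp: c_def)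
    thus "\<bar>\<xi>\<bar> < 1" using c1 by simp
    have "\<xi>\<^sup>2 \<le> c\<^sup>2" using le c by (simp add: abs_le_square_iff[symmetric])
    thus "\<bar>\<xi> / (1 - \<xi>\<^sup>2)\<bar> \<le> K"
      unfolding K_def abs_divide using le c c2 by (intro frac_le) auto
  qed
  define C where "C = (exp w\<^sub>0)\<^sup>2 * (3 * w\<^sub>0 + 11) * exp (3 * w\<^sub>0 + w\<^sub>0 * exp w\<^sub>0)
    * ((3 / (1 - 2 * K)) ^ 3 * exp (1 - 2 * K))"
  have C: "C > 0" unfolding C_def using assms(1) K by (intro mult_pos_pos) auto
  have bound: "\<bar>eta_isentropic \<theta> \<xi> \<rho> m - eta_isothermal \<xi> \<rho> m\<bar>
      + \<bar>q_isentropic \<theta> \<xi> \<rho> m - q_isothermal \<xi> \<rho> m\<bar> \<le> C * sqrt \<theta>"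
    if "0 < \<theta>" "\<theta> < 1" "admissible_state w\<^sub>0 \<rho> m" "\<xi> \<in> {a..b}" for \<theta> \<rho> m \<xi>
  proof (cases "0 < \<rho>")
    case True
    thus ?thesis unfolding C_def
      using that assms(1) K \<xi>[OF that(4)] by (intro entropy_pair_diff_le) auto
  next
    case False
    \<comment> \<open>At vacuum all four functions are 0.\<close>
    thus ?thesis using C that(1)
      by (simp add: eta_isentropic_def eta_isothermal_def q_isentropic_def q_isothermal_def)
  qed
  show ?thesis
  \<comment> \<open>\<open>C\<close> is built from w0, a and b alone. As \<open>bound\<close> covers
    all \<xi> at each admissible point, the null set of the hypothesis serves every \<xi>
    simultaneously.\<close>
  proof (intro exI[of _ C] conjI C ballI allI impI)
    fix \<theta>\<^sub>0 \<theta> :: real and \<rho> m :: "real \<times> real \<Rightarrow> real"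
    assume "\<theta>\<^sub>0 \<in> {0<..<1}" "\<theta> \<in> {0<..\<theta>\<^sub>0}"
    hence \<theta>: "0 < \<theta>" "\<theta> < 1" by auto
    assume "AE p in lebesgue_on half_plane. admissible_state w\<^sub>0 (\<rho> p) (m p)"
    thus "AE p in lebesgue_on half_plane. \<forall>\<xi>\<in>{a..b}.
       \<bar>eta_isentropic \<theta> \<xi> (\<rho> p) (m p) - eta_isothermal \<xi> (\<rho> p) (m p)\<bar>
     + \<bar>q_isentropic \<theta> \<xi> (\<rho> p) (m p) - q_isothermal \<xi> (\<rho> p) (m p)\<bar> \<le> C * sqrt \<theta>"
      by (rule eventually_mono) (use bound \<theta> in blast)
  qed
qed

end
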